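(* Let $T$ be a tree of order $n$. Then $$2\sqrt{5}+(n-3)\sqrt{2}\leq HSO(T)\leq (n-1)\sqrt{n^2-2n+2},$$ with left equality if and only if $T\cong P_n$ and right equality if and only if $T\cong S_n$.
   Context: All graphs are finite, simple and connected. For a graph $G$ with edge set $E(G)$, $d_i$ denotes the degree of the vertex $v_i$, and the Hyperbolic Sombor index is $HSO(G)=\sum_{v_iv_j\in E(G)}\frac{\sqrt{d_i^2+d_j^2}}{\min\{d_i,d_j\}}$. The order of a graph is its number of vertices. $P_n$ and $S_n$ denote the path and the star of order $n$, respectively.
   Formalization: The lower bound and its equality case are stated only for n ≥ 3, since they fail for n = 1 (HSO = 0 < 2√5 − 2√2) and n = 2 (HSO = √2 < 2√5 − √2); the upper bound and its equality case are stated for every tree. *)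

theory Defs
  imports Complex_Main "Graph_Theory.Graph_Theory"
begin

(* A finite simple graph is a pair_graph of the library: a finite, loop-free digraph without
   parallel arcs whose arc relation is symmetric.  The undirected edge {u,v} is thus
   represented by the two arcs (u,v) and (v,u). *)

definition edges :: "'a pair_pre_digraph \<Rightarrow> 'a set set" where
  "edges G = (\<lambda>(u, v). {u, v}) ` parcs G"

(* By symmetry of the arc relation the out-degree of v is its number of neighbours. *)
definition degree :: "'a pair_pre_digraph \<Rightarrow> 'a \<Rightarrow> nat" where
  "degree G v = out_degree (with_proj G) v"

(* The library predicates forest and tree are meant for digraphs: they count the closed walk
   u, v, u along (u,v) and (v,u) as a cycle, which excludes every undirected edge.
   A cycle of an undirected graph has length at least 3. *)
definition acyclic_graph :: "'a pair_pre_digraph \<Rightarrow> bool" where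
  "acyclic_graph G \<longleftrightarrow> \<not> (\<exists>p. pre_digraph.cycle (with_proj G) p \<and> 3 \<le> length p)"

definition tree_graph :: "'a pair_pre_digraph \<Rightarrow> bool" where
  "tree_graph G \<longleftrightarrow> pair_graph G \<and> connected (with_proj G) \<and> acyclic_graph G"

abbreviation graph_iso :: "'a pair_pre_digraph \<Rightarrow> 'b pair_pre_digraph \<Rightarrow> bool" (infix "\<cong>\<^sub>g" 50) where
  "G \<cong>\<^sub>g H \<equiv> digraph_iso (with_proj G) (with_proj H)"

(* Each edge contributes once; see edge_weight_pair for its summand in terms of its two ends. *)
definition edge_weight :: "'a pair_pre_digraph \<Rightarrow> 'a set \<Rightarrow> real" where
  "edge_weight G e = sqrt (\<Sum>v\<in>e. (real (degree G v))\<^sup>2) / real (Min (degree G ` e))"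

definition HSO :: "'a pair_pre_digraph \<Rightarrow> real" where
  "HSO G = (\<Sum>e\<in>edges G. edge_weight G e)"

lemma edge_weight_pair:
  assumes "u \<noteq> v"
  shows "edge_weight G {u, v} =
    sqrt ((real (degree G u))\<^sup>2 + (real (degree G v))\<^sup>2) / real (min (degree G u) (degree G v))"
  using assms by (simp add: edge_weight_def)

definition path_graph :: "nat \<Rightarrow> nat pair_pre_digraph" where
  "path_graph n = \<lparr> pverts = {..<n},
     parcs = {(i, j). i < n \<and> j < n \<and> (j = Suc i \<or> i = Suc j)} \<rparr>"

(* n is the number of vertices, so that the centre 0 has n - 1 neighbours. *)
definition star_graph :: "nat \<Rightarrow> nat pair_pre_digraph" where
  "star_graph n = \<lparr> pverts = {..<n},
     parcs = {(i, j). i < n \<and> j < n \<and> i \<noteq> j \<and> (i = 0 \<or> j = 0)} \<rparr>"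

lemma pair_graph_path_graph: "pair_graph (path_graph n)"
proof -
  have "finite (parcs (path_graph n))"
    by (rule finite_subset[of _ "{..<n} \<times> {..<n}"]) (auto simp: path_graph_def)
  then show ?thesis
    by unfold_locales (auto simp: path_graph_def symmetric_def sym_def)
qed

lemma pair_graph_star_graph: "pair_graph (star_graph n)"
proof -
  have "finite (parcs (star_graph n))"
    by (rule finite_subset[of _ "{..<n} \<times> {..<n}"]) (auto simp: star_graph_def)
  then show ?thesis
    by unfold_locales (auto simp: star_graph_def symmetric_def sym_def)
qed

end

theory Submission
  imports Defs
begin

text \<open>
  An edge with end degrees \<open>a \<le> b\<close> has weight \<open>sqrt (1 + (b / a)\<^sup>2)\<close>, so only the ratio of the
  two degrees matters, and a tree on \<open>n\<close> vertices has \<open>n - 1\<close> edges.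

  Upper bound: the ratio is at most the largest degree, hence at most \<open>n - 1\<close>, and bounding every
  edge by \<open>sqrt (1 + (n - 1)\<^sup>2)\<close> gives the claim (\<open>tree_HSO_le_max_degree\<close>). If no vertex has
  degree \<open>n - 1\<close>, the same estimate with \<open>n - 2\<close> is strictly smaller; so equality forces a vertex
  adjacent to all others. Its \<open>n - 1\<close> edges are then all the edges of the tree, which is a star.

  Lower bound: every edge weighs at least \<open>sqrt 2\<close>, and an edge at a leaf at least \<open>sqrt 5\<close>,
  because for \<open>n \<ge> 3\<close> the neighbour of a leaf is not a leaf. Hence the index is at least
  \<open>(n - 1) * sqrt 2 + (sqrt 5 - sqrt 2) * l\<close>, where \<open>l\<close> is the number of leaves
  (\<open>tree_HSO_lower\<close>), with equality when all degrees are at most two. The degrees sum to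
  \<open>2 * (n - 1)\<close>, so \<open>l \<ge> 2\<close>, with equality exactly when all degrees are at most two
  (\<open>tree_graph_card_leaves\<close>), and this in turn characterises the path
  (\<open>tree_graph_iso_path_iff\<close>).

  Both the number of edges and the shape of a tree with degrees at most two are found by induction,
  removing a leaf. Sums over edges are handled as half of sums over arcs, because a sum over arcs
  splits into its contributions at the tails and at the heads.
\<close>

section \<open>Degrees and edge sums\<close>

lemma degree_eq_card_neighbours: "degree G v = card {w. (v, w) \<in> parcs G}"
proof -
  have "out_arcs (with_proj G) v = Pair v ` {w. (v, w) \<in> parcs G}"
    by (auto simp: image_iff)
  then show ?thesis
    by (simp add: degree_def out_degree_def card_image inj_on_def)
qed

lemma degree_1_unique_neighbour:
  assumes "degree G v = 1" and "(v, x) \<in> parcs G" and "(v, y) \<in> parcs G"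
  shows "x = y"
  using assms unfolding degree_eq_card_neighbours
  by (metis card_1_singletonE mem_Collect_eq singletonD)

context pair_graph
begin

lemma arc_vertsD:
  assumes "(u, v) \<in> parcs G"
  shows "u \<in> pverts G" and "v \<in> pverts G" and "u \<noteq> v"
  using assms in_arcsD1 in_arcsD2 no_loops' by auto

lemma finite_neighbours: "finite {w. (v, w) \<in> parcs G}"
  by (rule finite_subset[OF _ pair_finite_verts]) (auto dest: arc_vertsD)

lemma neighbours_subset: "v \<in> pverts G \<Longrightarrow> {w. (v, w) \<in> parcs G} \<subseteq> pverts G - {v}"
  by (auto dest: arc_vertsD)

lemma degree_le:
  assumes "v \<in> pverts G"
  shows "degree G v \<le> card (pverts G) - 1"
  using card_mono[OF _ neighbours_subset[OF assms]] assms pair_finite_verts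
  by (simp add: degree_eq_card_neighbours)

lemma degree_pos:
  assumes "(v, w) \<in> parcs G"
  shows "1 \<le> degree G v"
  using assms finite_neighbours[of v] by (auto simp: degree_eq_card_neighbours Suc_le_eq card_gt_0_iff)

lemma parcs_eq_Sigma: "parcs G = Sigma (pverts G) (\<lambda>v. {w. (v, w) \<in> parcs G})"
  by (auto dest: arc_vertsD)

lemma sum_tails:
  fixes f :: "'a \<Rightarrow> real"
  shows "(\<Sum>(u, v)\<in>parcs G. f u) = (\<Sum>v\<in>pverts G. real (degree G v) * f v)"
  by (subst parcs_eq_Sigma, subst sum.Sigma[symmetric])
    (auto simp: pair_finite_verts finite_neighbours degree_eq_card_neighbours)

lemma sum_heads_eq_sum_tails:
  fixes f :: "'a \<Rightarrow> real"
  shows "(\<Sum>(u, v)\<in>parcs G. f v) = (\<Sum>(u, v)\<in>parcs G. f u)"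
  by (rule sum.reindex_bij_witness[of _ "\<lambda>(u, v). (v, u)" "\<lambda>(u, v). (v, u)"])
    (auto intro: arcs_symmetric)

text \<open>Each edge is the image of exactly two arcs, since there are no loops.\<close>

lemma sum_arcs_eq_sum_edges:
  fixes f :: "'a set \<Rightarrow> real"
  shows "(\<Sum>(u, v)\<in>parcs G. f {u, v}) = 2 * (\<Sum>e\<in>edges G. f e)"
proof -
  have "(\<Sum>(u, v)\<in>parcs G. f {u, v}) = (\<Sum>e\<in>edges G.
      \<Sum>a | a \<in> parcs G \<and> (case a of (u, v) \<Rightarrow> {u, v}) = e. (case a of (u, v) \<Rightarrow> f {u, v}))"
    unfolding edges_def by (rule sum.image_gen) (rule pair_finite_arcs)
  also have "\<dots> = (\<Sum>e\<in>edges G. 2 * f e)"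
  proof (rule sum.cong[OF refl])
    fix e assume "e \<in> edges G"
    then obtain u v where uv: "(u, v) \<in> parcs G" and e: "e = {u, v}"
      by (auto simp: edges_def)
    have "(case a of (x, y) \<Rightarrow> {x, y}) = {u, v} \<longleftrightarrow> a = (u, v) \<or> a = (v, u)" for a
      by (cases a) (simp add: doubleton_eq_iff)
    then have "{a \<in> parcs G. (case a of (x, y) \<Rightarrow> {x, y}) = e} = {(u, v), (v, u)}"
      unfolding e by (simp only:) (use uv arcs_symmetric[OF uv] in auto)
    then show "(\<Sum>a | a \<in> parcs G \<and> (case a of (u, v) \<Rightarrow> {u, v}) = e. (case a of (u, v) \<Rightarrow> f {u, v})) = 2 * f e"
      using arc_vertsD(3)[OF uv] by (simp add: e insert_commute[of v u])
  qed
  finally show ?thesis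
    by (simp add: sum_distrib_left)
qed

lemma card_parcs_eq: "card (parcs G) = 2 * card (edges G)"
  using sum_arcs_eq_sum_edges[of "\<lambda>_. 1"] by (simp add: case_prod_unfold)

lemma handshake: "(\<Sum>v\<in>pverts G. degree G v) = card (parcs G)"
proof -
  have "real (\<Sum>v\<in>pverts G. degree G v) = real (card (parcs G))"
    using sum_tails[of "\<lambda>_. 1"] by (simp add: case_prod_unfold)
  then show ?thesis
    by (simp only: of_nat_eq_iff)
qed

text \<open>
  The arc relation is already symmetric, so that the symmetrisation in the library definition of
  connectedness changes nothing. In this form, connectedness can be used by induction along walks.
\<close>

lemma connected_iff_rtrancl:
  "connected (with_proj G) \<longleftrightarrow>
    pverts G \<noteq> {} \<and> (\<forall>u\<in>pverts G. \<forall>v\<in>pverts G. (u, v) \<in> (parcs G)\<^sup>*)"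
proof -
  have "mk_symmetric (with_proj G) = G"
    by (rule pair_pre_digraph.equality)
      (auto simp: mk_symmetric_def intro: arcs_symmetric)
  then show ?thesis
    by (auto simp: connected_def strongly_connected_def reachable_conv')
qed

section \<open>Leaves and the number of edges of a tree\<close>

text \<open>
  The first vertex of a longest path: a neighbour off the path would extend the path, and a
  neighbour on the path other than the second vertex would close a cycle of length at least three.
\<close>

lemma exists_vertex_degree_le_1:
  assumes "acyclic_graph G" and "pverts G \<noteq> {}"
  shows "\<exists>v\<in>pverts G. degree G v \<le> 1"
proof -
  define P where "P k \<longleftrightarrow> (\<exists>u p v. apath u p v \<and> length p = k)" for k
  have "P 0"
    using assms(2) by (auto simp: P_def apath_Nil_iff)
  moreover have bound: "k \<le> card (pverts G)" if Pk: "P k" for k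
  proof -
    obtain u p v where up: "apath u p v" and k: "length p = k"
      using Pk by (auto simp: P_def)
    have "distinct (pawalk_verts u p)" and "set (pawalk_verts u p) \<subseteq> pverts G"
      using up by (auto simp: apath_def)
    then have "length (pawalk_verts u p) \<le> card (pverts G)"
      by (metis distinct_card card_mono pair_finite_verts)
    moreover have "length (pawalk_verts u p) = Suc (length p)"
      by (rule length_awalk_verts)
    ultimately show "k \<le> card (pverts G)"
      using k by simp
  qed
  ultimately obtain k where "P k" and max: "\<And>j. P j \<Longrightarrow> j \<le> k"
    using GreatestI_nat[of P 0] Greatest_le_nat[of P] by blast
  then obtain u p v where path: "apath u p v" and k: "length p = k"
    by (auto simp: P_def)
  have walk: "awalk u p v" and dist: "distinct (pawalk_verts u p)"
    using path by (auto simp: apath_def)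
  have neighbour: "x = snd (hd p)" if ux: "(u, x) \<in> parcs G" for x
  proof -
    have xu: "(x, u) \<in> parcs G"
      using ux by (rule arcs_symmetric)
    have "x \<in> set (pawalk_verts u p)"
    proof (rule ccontr)
      assume "x \<notin> set (pawalk_verts u p)"
      then have "apath x ((x, u) # p) v"
        using path xu by (simp add: apath_Cons_iff)
      then have "P (Suc k)"
        unfolding P_def using k by (metis length_Cons)
      then show False
        using max by fastforce
    qed
    \<comment> \<open>The initial segment \<open>q\<close> from \<open>u\<close> to \<open>x\<close>, closed up by the arc \<open>(x, u)\<close>, is a cycle.\<close>
    then obtain q r where pqr: "p = q @ r" and q: "awalk u q x"
      using awalk_decomp[OF walk] by blast
    have "distinct (pawalk_verts u q)"
      using dist walk awalk_verts_append[of u q r v] by (simp add: pqr)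
    then have "cycle ((x, u) # q)"
      using q xu by (auto simp: cycle_def awalk_Cons_iff)
    then have "length q < 2"
      using assms(1) by (force simp: acyclic_graph_def)
    moreover have "q \<noteq> []"
      using q arc_vertsD(3)[OF ux] by (auto simp: awalk_Nil_iff)
    ultimately obtain a where "q = [a]"
      by (cases q) auto
    then show ?thesis
      using q by (auto simp: pqr awalk_simps)
  qed
  then have "{w. (u, w) \<in> parcs G} \<subseteq> {snd (hd p)}"
    by auto
  then have "degree G u \<le> 1"
    unfolding degree_eq_card_neighbours by (metis card_mono finite.intros card_1_singleton_iff One_nat_def)
  moreover have "u \<in> pverts G"
    using walk by (rule awalk_hd_in_verts)
  ultimately show ?thesis
    by blast
qed

end

text \<open>
  This excludes isolated vertices and adjacent leaves in larger trees: no arc would leave the set of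
  these one or two vertices.
\<close>

lemma tree_graph_vertices_subset:
  assumes T: "tree_graph T" and v: "v \<in> pverts T" "v \<in> S"
    and closed: "\<And>x y. (x, y) \<in> parcs T \<Longrightarrow> x \<in> S \<Longrightarrow> y \<in> S"
  shows "pverts T \<subseteq> S"
proof
  interpret pair_graph T
    using T by (simp add: tree_graph_def)
  fix w assume "w \<in> pverts T"
  then have "(v, w) \<in> (parcs T)\<^sup>*"
    using T v by (simp add: tree_graph_def connected_iff_rtrancl)
  then show "w \<in> S"
    by induction (auto intro: v closed)
qed

lemma tree_graph_degree_pos:
  assumes T: "tree_graph T" and v: "v \<in> pverts T" and n: "2 \<le> card (pverts T)"
  shows "1 \<le> degree T v"
proof (rule ccontr)
  interpret pair_graph T
    using T by (simp add: tree_graph_def)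
  assume "\<not> 1 \<le> degree T v"
  then have "\<And>w. (v, w) \<notin> parcs T"
    using degree_pos by blast
  then have "pverts T \<subseteq> {v}"
    by (intro tree_graph_vertices_subset[OF T v]) auto
  then have "card (pverts T) \<le> 1"
    by (metis card_mono finite.intros card_1_singleton_iff One_nat_def)
  then show False
    using n by simp
qed

definition remove_vertex :: "'a pair_pre_digraph \<Rightarrow> 'a \<Rightarrow> 'a pair_pre_digraph" where
  "remove_vertex G v =
    \<lparr> pverts = pverts G - {v}, parcs = {(x, y) \<in> parcs G. x \<noteq> v \<and> y \<noteq> v} \<rparr>"

lemma remove_vertex_simps [simp]:
  "pverts (remove_vertex G v) = pverts G - {v}"
  "(x, y) \<in> parcs (remove_vertex G v) \<longleftrightarrow> (x, y) \<in> parcs G \<and> x \<noteq> v \<and> y \<noteq> v"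
  by (auto simp: remove_vertex_def)

lemma (in pair_graph) pair_graph_remove_vertex: "pair_graph (remove_vertex G v)"
proof -
  have "finite (parcs (remove_vertex G v))"
    by (rule finite_subset[OF _ pair_finite_arcs]) auto
  then show ?thesis
    by unfold_locales
      (auto simp: symmetric_def sym_def pair_finite_verts dest: arc_vertsD intro: arcs_symmetric)
qed

text \<open>
  The step of every induction on trees. To see that removing the leaf \<open>v\<close> with neighbour \<open>u\<close> keeps
  the rest connected, collapse \<open>v\<close> onto \<open>u\<close>: arcs become arcs of the smaller graph or
  stationary steps, so walks become walks that avoid \<open>v\<close>.
\<close>

lemma tree_graph_remove_leaf:
  assumes T: "tree_graph T" and n: "2 \<le> card (pverts T)"
    and v: "v \<in> pverts T" and deg: "degree T v \<le> 1"
  obtains u where "(v, u) \<in> parcs T" and "\<And>w. (v, w) \<in> parcs T \<Longrightarrow> w = u"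
    and "tree_graph (remove_vertex T v)"
proof -
  interpret pair_graph T
    using T by (simp add: tree_graph_def)
  have "degree T v = 1"
    using deg tree_graph_degree_pos[OF T v n] by simp
  then obtain u where u: "{w. (v, w) \<in> parcs T} = {u}"
    unfolding degree_eq_card_neighbours by (metis card_1_singletonE)
  then have vu: "(v, u) \<in> parcs T" and only: "\<And>w. (v, w) \<in> parcs T \<Longrightarrow> w = u"
    by auto
  let ?R = "remove_vertex T v"
  interpret R: pair_graph ?R
    by (rule pair_graph_remove_vertex)
  define g where "g x = (if x = v then u else x)" for x
  have reach: "(g x, g y) \<in> (parcs ?R)\<^sup>*" if "(x, y) \<in> (parcs T)\<^sup>*" for x y
    using that
  proof induction
    case (step y z)
    have "g y = g z \<or> (g y, g z) \<in> parcs ?R"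
      using step.hyps(2) only arcs_symmetric[OF step.hyps(2)] arc_vertsD(3)[OF step.hyps(2)]
      by (auto simp: g_def)
    then show ?case
      using step.IH by (auto intro: rtrancl_into_rtrancl)
  qed simp
  have "connected (with_proj ?R)"
    unfolding R.connected_iff_rtrancl
  proof (intro conjI ballI)
    show "pverts ?R \<noteq> {}"
      using arc_vertsD[OF vu] by auto
    fix x y assume xy: "x \<in> pverts ?R" "y \<in> pverts ?R"
    then have "(x, y) \<in> (parcs T)\<^sup>*"
      using T by (simp add: tree_graph_def connected_iff_rtrancl)
    then show "(x, y) \<in> (parcs ?R)\<^sup>*"
      using reach[of x y] xy by (simp add: g_def)
  qed
  moreover have "acyclic_graph ?R"
  proof -
    have "cycle p" if "R.cycle p" for p
      using that unfolding R.cycle_def cycle_def R.awalk_def awalk_def by force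
    then show ?thesis
      using T by (auto simp: tree_graph_def acyclic_graph_def)
  qed
  ultimately have "tree_graph ?R"
    using R.pair_graph by (simp add: tree_graph_def)
  then show ?thesis
    using that vu only by blast
qed

lemma tree_graph_exists_leaf:
  assumes T: "tree_graph T"
  obtains v where "v \<in> pverts T" and "degree T v \<le> 1"
proof -
  interpret pair_graph T
    using T by (simp add: tree_graph_def)
  show ?thesis
    using exists_vertex_degree_le_1 T that by (auto simp: tree_graph_def connected_iff_rtrancl)
qed

lemma tree_graph_card_pos: "tree_graph T \<Longrightarrow> 1 \<le> card (pverts T)"
  by (auto simp: tree_graph_def connected_def strongly_connected_def mk_symmetric_def Suc_le_eq
      card_gt_0_iff pair_graph_def pair_digraph_def pair_fin_digraph_def pair_fin_digraph_axioms_def)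

lemma tree_graph_card_1:
  assumes T: "tree_graph T" and "card (pverts T) = 1"
  obtains v where "pverts T = {v}" and "parcs T = {}"
proof -
  interpret pair_graph T
    using T by (simp add: tree_graph_def)
  obtain v where "pverts T = {v}"
    using assms(2) by (metis card_1_singletonE)
  then show ?thesis
    using that by (metis arc_vertsD equals0I prod.collapse singletonD)
qed

lemma tree_graph_card_parcs: "tree_graph T \<Longrightarrow> card (parcs T) = 2 * (card (pverts T) - 1)"
proof (induction "card (pverts T)" arbitrary: T)
  case 0
  then show ?case
    using tree_graph_card_pos by fastforce
next
  case (Suc n)
  note T = \<open>tree_graph T\<close>
  interpret pair_graph T
    using T by (simp add: tree_graph_def)
  show ?case
  proof (cases "n = 0")
    case True
    then show ?thesis
      using tree_graph_card_1[OF T] Suc.hyps(2) by auto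
  next
    case False
    then have n: "2 \<le> card (pverts T)"
      using Suc.hyps(2) by simp
    obtain v where v: "v \<in> pverts T" "degree T v \<le> 1"
      using tree_graph_exists_leaf[OF T] .
    obtain u where vu: "(v, u) \<in> parcs T" and only: "\<And>w. (v, w) \<in> parcs T \<Longrightarrow> w = u"
      and R: "tree_graph (remove_vertex T v)"
      using tree_graph_remove_leaf[OF T n v] by blast
    let ?R = "remove_vertex T v"
    have parcs: "parcs T = insert (v, u) (insert (u, v) (parcs ?R))"
      using vu arcs_symmetric[OF vu] by (auto dest: only arcs_symmetric[THEN only])
    have "finite (parcs ?R)"
      using parcs pair_finite_arcs by (metis finite_insert)
    then have "card (parcs T) = 2 + card (parcs ?R)"
      using arc_vertsD(3)[OF vu] unfolding parcs by simp
    moreover have "card (pverts ?R) = n"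
      using v Suc.hyps(2) by simp
    ultimately show ?thesis
      using Suc.hyps(1)[OF _ R] False Suc.hyps(2) by simp
  qed
qed


section \<open>Recognising paths and stars by their degrees\<close>

text \<open>
  Library isomorphisms carry their own arc map and new head and tail functions; for graphs without
  parallel arcs all of these are determined by the vertex bijection.
\<close>

lemma graph_isoI:
  assumes G: "pair_graph G" and H: "pair_graph H"
    and f: "bij_betw f (pverts G) (pverts H)"
    and arcs: "\<And>x y. x \<in> pverts G \<Longrightarrow> y \<in> pverts G \<Longrightarrow>
      (x, y) \<in> parcs G \<longleftrightarrow> (f x, f y) \<in> parcs H"
  shows "G \<cong>\<^sub>g H"
proof -
  interpret G: pair_graph G by (rule G)
  interpret H: pair_graph H by (rule H)
  define \<phi> where "\<phi> = \<lparr> iso_verts = f, iso_arcs = map_prod f f, iso_head = snd, iso_tail = fst \<rparr>"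
  have inj: "inj_on f (pverts G)" and im: "f ` pverts G = pverts H"
    using f by (auto simp: bij_betw_def)
  have "inj_on (map_prod f f) (parcs G)"
    by (rule inj_on_subset[OF map_prod_inj_on[OF inj inj]]) (auto dest: G.arc_vertsD)
  then have "G.digraph_isomorphism \<phi>"
    using inj G.wf_digraph by (simp add: G.digraph_isomorphism_def \<phi>_def)
  moreover have "map_prod f f ` parcs G = parcs H"
  proof
    have "(f x, f y) \<in> parcs H" if "(x, y) \<in> parcs G" for x y
      using arcs[of x y] G.arc_vertsD[OF that] that by simp
    then show "map_prod f f ` parcs G \<subseteq> parcs H"
      by auto
    show "parcs H \<subseteq> map_prod f f ` parcs G"
    proof
      fix a assume a: "a \<in> parcs H"
      obtain x' y' where a_eq: "a = (x', y')"
        by (cases a)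
      then have "x' \<in> f ` pverts G" "y' \<in> f ` pverts G"
        using a H.arc_vertsD im by auto
      then obtain x y where xy: "x \<in> pverts G" "y \<in> pverts G" "x' = f x" "y' = f y"
        by blast
      then have "(x, y) \<in> parcs G"
        using arcs a a_eq by simp
      then show "a \<in> map_prod f f ` parcs G"
        using a_eq xy by (auto intro: rev_image_eqI)
    qed
  qed
  ultimately show ?thesis
    using im unfolding digraph_iso_def
    by (intro exI[of _ \<phi>]) (simp add: app_iso_def \<phi>_def with_proj_def)
qed

text \<open>
  Degrees are enough to recognise both extremal graphs among trees, so this is what an isomorphism
  is used for.
\<close>

lemma graph_iso_degrees:
  assumes "G \<cong>\<^sub>g H"
  obtains f where "f ` pverts G = pverts H"
    and "\<And>v. v \<in> pverts G \<Longrightarrow> degree H (f v) = degree G v"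
proof -
  obtain \<phi> where \<phi>: "pre_digraph.digraph_isomorphism (with_proj G) \<phi>"
    and H: "with_proj H = app_iso \<phi> (with_proj G)"
    using assms by (auto simp: digraph_iso_def)
  interpret wf_digraph "with_proj G"
    using \<phi> by (simp add: pre_digraph.digraph_isomorphism_def)
  show ?thesis
  proof (rule that[of "iso_verts \<phi>"])
    show "iso_verts \<phi> ` pverts G = pverts H"
      by (metis H verts_app_iso with_proj_simps(1))
    show "degree H (iso_verts \<phi> v) = degree G v" if "v \<in> pverts G" for v
      using out_degree_app_iso_eq[OF \<phi>] that by (simp add: degree_def H)
  qed
qed

text \<open>
  Prescribing that the given end vertex gets the last label makes the induction work: after
  removing the leaf \<open>v\<close>, its neighbour \<open>u\<close> has lost a neighbour and is a possible end vertex of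
  the rest, so \<open>u\<close> has the last label there and \<open>v\<close> can be appended after it.
\<close>

lemma tree_path_labelling:
  assumes "tree_graph T" and "\<And>x. x \<in> pverts T \<Longrightarrow> degree T x \<le> 2"
    and "v \<in> pverts T" and "degree T v \<le> 1"
  shows "\<exists>f. bij_betw f (pverts T) {..<card (pverts T)} \<and> Suc (f v) = card (pverts T) \<and>
    (\<forall>x\<in>pverts T. \<forall>y\<in>pverts T. (x, y) \<in> parcs T \<longleftrightarrow> f y = Suc (f x) \<or> f x = Suc (f y))"
  using assms
proof (induction "card (pverts T)" arbitrary: T v)
  case 0
  then show ?case
    using tree_graph_card_pos by fastforce
next
  case (Suc n)
  note T = \<open>tree_graph T\<close> and v = \<open>v \<in> pverts T\<close> \<open>degree T v \<le> 1\<close>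
  interpret pair_graph T
    using T by (simp add: tree_graph_def)
  show ?case
  proof (cases "n = 0")
    case True
    then have 1: "card (pverts T) = 1"
      using Suc.hyps(2) by simp
    obtain w where "pverts T = {w}" "parcs T = {}"
      using tree_graph_card_1[OF T 1] .
    then show ?thesis
      using v by (intro exI[of _ "\<lambda>_. 0"]) (auto simp: bij_betw_def)
  next
    case False
    then have n: "2 \<le> card (pverts T)"
      using Suc.hyps(2) by simp
    obtain u where vu: "(v, u) \<in> parcs T" and only: "\<And>w. (v, w) \<in> parcs T \<Longrightarrow> w = u"
      and R: "tree_graph (remove_vertex T v)"
      using tree_graph_remove_leaf[OF T n v] by blast
    let ?R = "remove_vertex T v"
    have uv: "(u, v) \<in> parcs T"
      using vu by (rule arcs_symmetric)
    have u: "u \<in> pverts ?R"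
      using arc_vertsD[OF vu] by simp
    have n_R: "n = card (pverts ?R)"
      using v Suc.hyps(2) by simp
    have nbs: "{w. (x, w) \<in> parcs ?R} = {w. (x, w) \<in> parcs T} - {v}" if "x \<noteq> v" for x
      using that by auto
    have deg_R: "degree ?R x \<le> 2" if "x \<in> pverts ?R" for x
    proof -
      have "degree ?R x \<le> degree T x"
        unfolding degree_eq_card_neighbours using that
        by (intro card_mono finite_neighbours) auto
      then show ?thesis
        using Suc.prems(2)[of x] that by simp
    qed
    have deg_u: "degree ?R u \<le> 1"
      using Suc.prems(2)[of u] uv u nbs[of u] finite_neighbours[of u]
      by (simp add: degree_eq_card_neighbours)
    obtain f where f: "bij_betw f (pverts ?R) {..<n}" and fu: "Suc (f u) = n"
      and arcs: "\<And>x y. x \<in> pverts ?R \<Longrightarrow> y \<in> pverts ?R \<Longrightarrow>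
        (x, y) \<in> parcs ?R \<longleftrightarrow> f y = Suc (f x) \<or> f x = Suc (f y)"
      using Suc.hyps(1)[OF n_R R deg_R u deg_u] unfolding n_R[symmetric] by blast
    define g where "g = f(v := n)"
    have g_R: "g x = f x" "f x < n" if "x \<in> pverts ?R" for x
      using that f by (auto simp: g_def bij_betw_def)
    have gv: "g v = n"
      by (simp add: g_def)
    have fx_u: "Suc (f x) = n \<longleftrightarrow> x = u" if "x \<in> pverts ?R" for x
      using f fu u that by (metis Suc_inject bij_betw_def inj_onD)
    have V: "pverts T = insert v (pverts ?R)"
      using v by auto
    have "bij_betw g (pverts ?R) {..<n}"
      using f by (rule bij_betw_cong[THEN iffD2, rotated]) (rule g_R(1))
    then have "bij_betw g (pverts ?R \<union> {v}) ({..<n} \<union> {g v})"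
      by (intro notIn_Un_bij_betw) (auto simp: gv)
    then have "bij_betw g (pverts T) {..<Suc n}"
      unfolding V gv by (simp add: lessThan_Suc)
    moreover have "(x, y) \<in> parcs T \<longleftrightarrow> g y = Suc (g x) \<or> g x = Suc (g y)"
      if xy: "x \<in> pverts T" "y \<in> pverts T" for x y
    proof -
      have vx: "(v, x) \<in> parcs T \<longleftrightarrow> x = u" "(x, v) \<in> parcs T \<longleftrightarrow> x = u" for x
        using vu uv only arcs_symmetric by blast+
      consider "x = v" "y = v" | "x = v" "y \<in> pverts ?R" | "x \<in> pverts ?R" "y = v"
        | "x \<in> pverts ?R" "y \<in> pverts ?R"
        using xy V by blast
      then show ?thesis
      proof cases
        case 1
        then show ?thesis
          using arc_vertsD(3)[of v v] by auto
      next
        case 2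
        then show ?thesis
          using fx_u[of y] g_R[of y] gv vx by fastforce
      next
        case 3
        then show ?thesis
          using fx_u[of x] g_R[of x] gv vx by fastforce
      next
        case 4
        then show ?thesis
          using arcs[of x y] g_R[of x] g_R[of y] by simp
      qed
    qed
    ultimately show ?thesis
      using gv Suc.hyps(2) by (intro exI[of _ g]) simp
  qed
qed

lemma degree_path_graph_le_2: "degree (path_graph n) i \<le> 2"
proof -
  have "{w. (i, w) \<in> parcs (path_graph n)} \<subseteq> {i - 1, Suc i}"
    by (auto simp: path_graph_def)
  then have "card {w. (i, w) \<in> parcs (path_graph n)} \<le> card {i - 1, Suc i}"
    by (intro card_mono) auto
  also have "\<dots> \<le> 2"
    by (simp add: card_insert_if)
  finally show ?thesis
    by (simp add: degree_eq_card_neighbours)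
qed

lemma tree_graph_iso_path_iff:
  assumes T: "tree_graph T" and n: "card (pverts T) = n"
  shows "T \<cong>\<^sub>g path_graph n \<longleftrightarrow> (\<forall>v\<in>pverts T. degree T v \<le> 2)"
proof
  assume "T \<cong>\<^sub>g path_graph n"
  then show "\<forall>v\<in>pverts T. degree T v \<le> 2"
    by (metis graph_iso_degrees degree_path_graph_le_2)
next
  assume deg: "\<forall>v\<in>pverts T. degree T v \<le> 2"
  obtain v where v: "v \<in> pverts T" "degree T v \<le> 1"
    using tree_graph_exists_leaf[OF T] .
  obtain f where f: "bij_betw f (pverts T) {..<n}"
    and arcs: "\<And>x y. x \<in> pverts T \<Longrightarrow> y \<in> pverts T \<Longrightarrow>
      (x, y) \<in> parcs T \<longleftrightarrow> f y = Suc (f x) \<or> f x = Suc (f y)"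
    using tree_path_labelling[OF T _ v] deg unfolding n by blast
  have "f x < n" if "x \<in> pverts T" for x
    using f that by (auto simp: bij_betw_def)
  then show "T \<cong>\<^sub>g path_graph n"
    using T f arcs pair_graph_path_graph
    by (intro graph_isoI[of _ _ f]) (auto simp: tree_graph_def path_graph_def)
qed

text \<open>
  The arcs between \<open>c\<close> and the other vertices already number \<open>2 * (n - 1)\<close>, as many as the tree has.
\<close>

lemma tree_parcs_full_degree:
  assumes T: "tree_graph T" and c: "c \<in> pverts T" and deg: "degree T c = card (pverts T) - 1"
  shows "parcs T = {c} \<times> (pverts T - {c}) \<union> (pverts T - {c}) \<times> {c}"
proof -
  interpret pair_graph T
    using T by (simp add: tree_graph_def)
  let ?W = "pverts T - {c}"
  have fin: "finite ?W"
    using pair_finite_verts by simp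
  have "{w. (c, w) \<in> parcs T} = ?W"
    using c deg
    by (intro card_subset_eq fin neighbours_subset) (simp_all add: degree_eq_card_neighbours)
  then have sub: "{c} \<times> ?W \<union> ?W \<times> {c} \<subseteq> parcs T"
    using arcs_symmetric by blast
  have "card ({c} \<times> ?W \<union> ?W \<times> {c}) = card ({c} \<times> ?W) + card (?W \<times> {c})"
    using fin by (intro card_Un_disjoint) auto
  also have "\<dots> = card (parcs T)"
    using c by (simp add: tree_graph_card_parcs[OF T] card_cartesian_product)
  finally show ?thesis
    using card_subset_eq[OF pair_finite_arcs sub] by simp
qed

lemma tree_graph_iso_star_iff:
  assumes T: "tree_graph T" and n: "card (pverts T) = n"
  shows "T \<cong>\<^sub>g star_graph n \<longleftrightarrow> (\<exists>c\<in>pverts T. degree T c = n - 1)"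
proof
  assume "T \<cong>\<^sub>g star_graph n"
  then obtain f where f: "f ` pverts T = {..<n}"
    and deg: "\<And>v. v \<in> pverts T \<Longrightarrow> degree (star_graph n) (f v) = degree T v"
    by (elim graph_iso_degrees) (simp add: star_graph_def)
  have "0 < n"
    using tree_graph_card_pos[OF T] n by simp
  then obtain c where c: "c \<in> pverts T" "f c = 0"
    using f by (metis imageE lessThan_iff)
  have "{w. (0, w) \<in> parcs (star_graph n)} = {1..<n}"
    by (auto simp: star_graph_def)
  then have "degree (star_graph n) 0 = n - 1"
    by (simp add: degree_eq_card_neighbours)
  then show "\<exists>c\<in>pverts T. degree T c = n - 1"
    using c deg by metis
next
  assume "\<exists>c\<in>pverts T. degree T c = n - 1"
  then obtain c where c: "c \<in> pverts T" and deg: "degree T c = n - 1"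
    by blast
  interpret pair_graph T
    using T by (simp add: tree_graph_def)
  have parcs: "parcs T = {c} \<times> (pverts T - {c}) \<union> (pverts T - {c}) \<times> {c}"
    using tree_parcs_full_degree[OF T c] deg n by simp
  obtain f where f: "bij_betw f (pverts T - {c}) {1..<n}"
    using finite_same_card_bij[of "pverts T - {c}" "{1..<n}"] c n pair_finite_verts by auto
  define g where "g = f(c := 0)"
  have gc: "g c = 0"
    by (simp add: g_def)
  have g_range: "0 < g x" "g x < n" if "x \<in> pverts T - {c}" for x
  proof -
    have "f x \<in> {1..<n}"
      using f that by (auto simp: bij_betw_def)
    then show "0 < g x" "g x < n"
      using that by (auto simp: g_def)
  qed
  have "bij_betw g (pverts T - {c}) {1..<n}"
    using f by (rule bij_betw_cong[THEN iffD1, rotated]) (simp add: g_def)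
  then have "bij_betw g (pverts T - {c} \<union> {c}) ({1..<n} \<union> {g c})"
    by (intro notIn_Un_bij_betw) (auto simp: gc)
  moreover have "pverts T - {c} \<union> {c} = pverts T"
    using c by auto
  moreover have "{1..<n} \<union> {g c} = {..<n}"
    using tree_graph_card_pos[OF T] n by (auto simp: gc)
  ultimately have bij: "bij_betw g (pverts T) {..<n}"
    by simp
  have "(x, y) \<in> parcs T \<longleftrightarrow> (g x, g y) \<in> parcs (star_graph n)"
    if xy: "x \<in> pverts T" "y \<in> pverts T" for x y
  proof -
    have g: "g z < n" "g z = 0 \<longleftrightarrow> z = c" if "z \<in> pverts T" for z
      using g_range[of z] gc that bij by (auto simp: bij_betw_def)
    have "g x = g y \<longleftrightarrow> x = y"
      using bij xy by (auto simp: bij_betw_def inj_on_eq_iff)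
    then have "(g x, g y) \<in> parcs (star_graph n) \<longleftrightarrow> x \<noteq> y \<and> (x = c \<or> y = c)"
      using g[OF xy(1)] g[OF xy(2)] by (simp add: star_graph_def)
    then show ?thesis
      using xy unfolding parcs by auto
  qed
  then show "T \<cong>\<^sub>g star_graph n"
    using bij pair_graph pair_graph_star_graph
    by (intro graph_isoI[of _ _ g]) (auto simp: star_graph_def)
qed


section \<open>The two bounds\<close>

text \<open>
  Charging the surplus \<open>sqrt 5 - sqrt 2\<close> of a leaf edge to its leaf makes the estimate additive in
  the two ends, so that it can be summed vertex by vertex.
\<close>

lemma edge_ratio_lower:
  fixes a b :: nat
  assumes "1 \<le> a" "1 \<le> b" "\<not> (a = 1 \<and> b = 1)"
  shows "sqrt 2 + (sqrt 5 - sqrt 2) * (of_bool (a = 1) + of_bool (b = 1))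
    \<le> sqrt ((real a)\<^sup>2 + (real b)\<^sup>2) / real (min a b)"
  using assms
proof (induction a b rule: linorder_wlog)
  case (le a b)
  show ?case
  proof (cases "a = 1")
    case True
    then have "(2::real) ^ 2 \<le> (real b)\<^sup>2"
      using le by (intro power_mono) auto
    then show ?thesis
      using True le by simp
  next
    case False
    have "(real a)\<^sup>2 \<le> (real b)\<^sup>2"
      using le by (intro power_mono) auto
    then have "sqrt 2 * real a \<le> sqrt ((real a)\<^sup>2 + (real b)\<^sup>2)"
      by (intro real_le_rsqrt) (simp add: power_mult_distrib)
    then show ?thesis
      using False le by (simp add: field_simps)
  qed
next
  case (sym a b)
  then show ?case
    by (simp add: add.commute min.commute conj_commute)
qed

lemma edge_ratio_eq:
  fixes a b :: nat
  assumes "1 \<le> a" "a \<le> 2" "1 \<le> b" "b \<le> 2" "\<not> (a = 1 \<and> b = 1)"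
  shows "sqrt ((real a)\<^sup>2 + (real b)\<^sup>2) / real (min a b)
    = sqrt 2 + (sqrt 5 - sqrt 2) * (of_bool (a = 1) + of_bool (b = 1))"
proof -
  have "sqrt 8 = 2 * sqrt 2"
    using real_sqrt_mult[of 4 2] by simp
  moreover have "a = 1 \<and> b = 2 \<or> a = 2 \<and> b = 1 \<or> a = 2 \<and> b = 2"
    using assms by auto
  ultimately show ?thesis
    by auto
qed

text \<open>
  With \<open>a \<le> b\<close>, the claim is \<open>b \<le> a * m\<close> after squaring, and \<open>b \<le> m \<le> a * m\<close>.
\<close>

lemma edge_ratio_upper:
  fixes a b m :: nat
  assumes "1 \<le> a" "1 \<le> b" "a \<le> m" "b \<le> m"
  shows "sqrt ((real a)\<^sup>2 + (real b)\<^sup>2) / real (min a b) \<le> sqrt (1 + (real m)\<^sup>2)"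
  using assms
proof (induction a b rule: linorder_wlog)
  case (le a b)
  have "real b \<le> real a * real m"
    using mult_mono[of 1 "real a" "real b" "real m"] le by simp
  then have "(real b)\<^sup>2 \<le> (real a * real m)\<^sup>2"
    by (intro power_mono) auto
  then have "sqrt ((real a)\<^sup>2 + (real b)\<^sup>2) \<le> sqrt ((real a)\<^sup>2 * (1 + (real m)\<^sup>2))"
    by (intro real_sqrt_le_mono) (simp add: algebra_simps power_mult_distrib)
  also have "\<dots> = real a * sqrt (1 + (real m)\<^sup>2)"
    by (simp add: real_sqrt_mult)
  finally show ?case
    using le by (simp add: field_simps)
next
  case (sym a b)
  then show ?case
    by (simp add: add.commute min.commute)
qed

definition leaves :: "'a pair_pre_digraph \<Rightarrow> 'a set" where
  "leaves G = {v \<in> pverts G. degree G v = 1}"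

lemma tree_graph_card_edges:
  assumes T: "tree_graph T"
  shows "card (edges T) = card (pverts T) - 1"
proof -
  interpret pair_graph T
    using T by (simp add: tree_graph_def)
  show ?thesis
    using card_parcs_eq tree_graph_card_parcs[OF T] by simp
qed

text \<open>
  Raising the degree of each leaf by one makes all degrees at least two, while the sum becomes
  \<open>2 * (n - 1) + l\<close> for \<open>l\<close> leaves; compare it with \<open>2 * n\<close>.
\<close>

lemma tree_graph_card_leaves:
  assumes T: "tree_graph T" and n: "2 \<le> card (pverts T)"
  shows "2 \<le> card (leaves T)"
    and "card (leaves T) = 2 \<longleftrightarrow> (\<forall>v\<in>pverts T. degree T v \<le> 2)"
proof -
  interpret pair_graph T
    using T by (simp add: tree_graph_def)
  let ?h = "\<lambda>v. degree T v + of_bool (degree T v = 1)"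
  have ge: "2 \<le> ?h v" if "v \<in> pverts T" for v
    using tree_graph_degree_pos[OF T that n] by (cases "degree T v = 1") auto
  have "(\<Sum>v\<in>pverts T. of_bool (degree T v = 1) :: nat) = card (leaves T)"
    unfolding leaves_def using pair_finite_verts by (simp add: Int_def)
  then have sum_h: "(\<Sum>v\<in>pverts T. ?h v) = 2 * (card (pverts T) - 1) + card (leaves T)"
    by (simp add: sum.distrib handshake tree_graph_card_parcs[OF T])
  moreover have "(\<Sum>v\<in>pverts T. 2) \<le> (\<Sum>v\<in>pverts T. ?h v)"
    using ge by (rule sum_mono)
  ultimately show "2 \<le> card (leaves T)"
    using n by simp
  have "card (leaves T) = 2 \<longleftrightarrow> (\<Sum>v\<in>pverts T. 2) = (\<Sum>v\<in>pverts T. ?h v)"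
    using n unfolding sum_h by auto
  also have "\<dots> \<longleftrightarrow> (\<forall>v\<in>pverts T. 2 = ?h v)"
    using sum_mono_inv[of "\<lambda>_. 2" "pverts T" ?h] ge pair_finite_verts
    by (metis (no_types, lifting) sum.cong)
  also have "\<dots> \<longleftrightarrow> (\<forall>v\<in>pverts T. degree T v \<le> 2)"
    using ge by (fastforce split: if_splits)
  finally show "card (leaves T) = 2 \<longleftrightarrow> (\<forall>v\<in>pverts T. degree T v \<le> 2)" .
qed

lemma tree_graph_leaves_not_adjacent:
  assumes T: "tree_graph T" and n: "3 \<le> card (pverts T)" and uv: "(u, v) \<in> parcs T"
  shows "\<not> (degree T u = 1 \<and> degree T v = 1)"
proof
  interpret pair_graph T
    using T by (simp add: tree_graph_def)
  assume deg: "degree T u = 1 \<and> degree T v = 1"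
  then have "w = v" if "(u, w) \<in> parcs T" for w
    using degree_1_unique_neighbour uv that by metis
  moreover have "w = u" if "(v, w) \<in> parcs T" for w
    using degree_1_unique_neighbour arcs_symmetric[OF uv] that deg by metis
  ultimately have "pverts T \<subseteq> {u, v}"
    using arc_vertsD(1)[OF uv] by (intro tree_graph_vertices_subset[OF T]) auto
  then have "card (pverts T) \<le> card {u, v}"
    by (intro card_mono) auto
  then show False
    using n by (simp add: card_insert_if split: if_splits)
qed

text \<open>
  Summed over arcs, an indicator at the tail counts each vertex as often as its degree, and a leaf
  thus exactly once; the heads contribute the same by symmetry.
\<close>

lemma sum_leaf_weights:
  assumes T: "tree_graph T"
  shows "(\<Sum>(u, v)\<in>parcs T. c + d * (of_bool (degree T u = 1) + of_bool (degree T v = 1)))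
    = 2 * ((real (card (pverts T)) - 1) * c + d * real (card (leaves T)))"
proof -
  interpret pair_graph T
    using T by (simp add: tree_graph_def)
  define h :: "'a \<Rightarrow> real" where "h v = of_bool (degree T v = 1)" for v
  have "(\<Sum>(u, v)\<in>parcs T. c + d * (h u + h v))
      = real (card (parcs T)) * c + d * ((\<Sum>(u, v)\<in>parcs T. h u) + (\<Sum>(u, v)\<in>parcs T. h v))"
    by (simp add: case_prod_unfold sum.distrib sum_distrib_left distrib_left)
  also have "\<dots> = real (card (parcs T)) * c + 2 * d * (\<Sum>v\<in>pverts T. real (degree T v) * h v)"
    by (simp add: sum_heads_eq_sum_tails sum_tails)
  also have "(\<Sum>v\<in>pverts T. real (degree T v) * h v) = (\<Sum>v\<in>pverts T. of_bool (degree T v = 1))"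
    by (rule sum.cong) (auto simp: h_def)
  also have "\<dots> = real (card (leaves T))"
    unfolding leaves_def using pair_finite_verts by (simp add: Int_def)
  finally show ?thesis
    using tree_graph_card_pos[OF T] tree_graph_card_parcs[OF T]
    by (simp add: h_def of_nat_diff algebra_simps)
qed

lemma tree_HSO_lower:
  assumes T: "tree_graph T" and n: "3 \<le> card (pverts T)"
  shows "(real (card (pverts T)) - 1) * sqrt 2 + (sqrt 5 - sqrt 2) * real (card (leaves T)) \<le> HSO T"
    and "(\<forall>v\<in>pverts T. degree T v \<le> 2) \<Longrightarrow>
      HSO T = (real (card (pverts T)) - 1) * sqrt 2 + (sqrt 5 - sqrt 2) * real (card (leaves T))"
proof -
  interpret pair_graph T
    using T by (simp add: tree_graph_def)
  let ?g = "\<lambda>u v. sqrt 2 + (sqrt 5 - sqrt 2) * (of_bool (degree T u = 1) + of_bool (degree T v = 1))"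
  have HSO: "2 * HSO T = (\<Sum>(u, v)\<in>parcs T. edge_weight T {u, v})"
    unfolding HSO_def by (rule sum_arcs_eq_sum_edges[symmetric])
  have pos: "1 \<le> degree T u" "1 \<le> degree T v" if "(u, v) \<in> parcs T" for u v
    using that arcs_symmetric degree_pos by blast+
  have "?g u v \<le> edge_weight T {u, v}" if uv: "(u, v) \<in> parcs T" for u v
    using edge_ratio_lower[OF pos[OF uv] tree_graph_leaves_not_adjacent[OF T n uv]]
      arc_vertsD(3)[OF uv] by (simp add: edge_weight_pair)
  then have "(\<Sum>(u, v)\<in>parcs T. ?g u v) \<le> 2 * HSO T"
    unfolding HSO by (intro sum_mono) auto
  then show "(real (card (pverts T)) - 1) * sqrt 2 + (sqrt 5 - sqrt 2) * real (card (leaves T)) \<le> HSO T"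
    unfolding sum_leaf_weights[OF T] by simp
  assume deg: "\<forall>v\<in>pverts T. degree T v \<le> 2"
  have "edge_weight T {u, v} = ?g u v" if uv: "(u, v) \<in> parcs T" for u v
    using edge_ratio_eq[OF pos(1)[OF uv] _ pos(2)[OF uv] _ tree_graph_leaves_not_adjacent[OF T n uv]]
      arc_vertsD[OF uv] deg by (simp add: edge_weight_pair)
  then have "2 * HSO T = (\<Sum>(u, v)\<in>parcs T. ?g u v)"
    unfolding HSO by (intro sum.cong) auto
  then show "HSO T = (real (card (pverts T)) - 1) * sqrt 2 + (sqrt 5 - sqrt 2) * real (card (leaves T))"
    unfolding sum_leaf_weights[OF T] by simp
qed

lemma tree_HSO_le_max_degree:
  assumes T: "tree_graph T" and deg: "\<And>v. v \<in> pverts T \<Longrightarrow> degree T v \<le> m"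
  shows "HSO T \<le> (real (card (pverts T)) - 1) * sqrt (1 + (real m)\<^sup>2)"
proof -
  interpret pair_graph T
    using T by (simp add: tree_graph_def)
  have "edge_weight T e \<le> sqrt (1 + (real m)\<^sup>2)" if e_in: "e \<in> edges T" for e
  proof -
    obtain u v where uv: "(u, v) \<in> parcs T" and e: "e = {u, v}"
      using e_in by (auto simp: edges_def)
    show ?thesis
      using edge_ratio_upper[OF degree_pos[OF uv] degree_pos[OF arcs_symmetric[OF uv]] deg deg]
        arc_vertsD[OF uv] by (simp add: e edge_weight_pair)
  qed
  then have "HSO T \<le> real (card (edges T)) * sqrt (1 + (real m)\<^sup>2)"
    unfolding HSO_def by (rule sum_bounded_above)
  then show ?thesis
    using tree_graph_card_edges[OF T] tree_graph_card_pos[OF T] by (simp add: of_nat_diff)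
qed

lemma tree_HSO_full_degree:
  assumes T: "tree_graph T" and c: "c \<in> pverts T" and deg: "degree T c = card (pverts T) - 1"
  shows "HSO T = (real (card (pverts T)) - 1) * sqrt (1 + (real (card (pverts T) - 1))\<^sup>2)"
proof -
  interpret pair_graph T
    using T by (simp add: tree_graph_def)
  note parcs = tree_parcs_full_degree[OF T c deg]
  have "edge_weight T e = sqrt (1 + (real (card (pverts T) - 1))\<^sup>2)" if e_in: "e \<in> edges T" for e
  proof -
    obtain x where x: "x \<in> pverts T" "x \<noteq> c" and e: "e = {c, x}"
      using e_in unfolding edges_def parcs by auto
    have "{w. (x, w) \<in> parcs T} = {c}"
      unfolding parcs using x by auto
    then have "degree T x = 1"
      by (simp add: degree_eq_card_neighbours)
    moreover have "1 \<le> degree T c"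
      using x by (intro degree_pos[of c x]) (simp add: parcs)
    ultimately show ?thesis
      using x(2) by (simp add: e edge_weight_pair deg add.commute)
  qed
  then have "HSO T = real (card (edges T)) * sqrt (1 + (real (card (pverts T) - 1))\<^sup>2)"
    unfolding HSO_def by simp
  then show ?thesis
    using tree_graph_card_edges[OF T] tree_graph_card_pos[OF T] by (simp add: of_nat_diff)
qed

theorem theorem2p4:
  fixes T :: "'a pair_pre_digraph" and n :: nat
  assumes "tree_graph T" and "card (pverts T) = n"
  shows "(3 \<le> n \<longrightarrow>
            2 * sqrt 5 + (real n - 3) * sqrt 2 \<le> HSO T \<and>
            (2 * sqrt 5 + (real n - 3) * sqrt 2 = HSO T \<longleftrightarrow> T \<cong>\<^sub>g path_graph n)) \<and>
         HSO T \<le> (real n - 1) * sqrt ((real n)\<^sup>2 - 2 * real n + 2) \<and>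
         (HSO T = (real n - 1) * sqrt ((real n)\<^sup>2 - 2 * real n + 2) \<longleftrightarrow> T \<cong>\<^sub>g star_graph n)"
proof (intro conjI impI)
  note T = assms(1) and n = assms(2)
  interpret pair_graph T
    using T by (simp add: tree_graph_def)
  \<comment> \<open>The claimed lower bound is the one by the number of leaves, evaluated at two leaves.\<close>
  have lower_eq: "(real n - 1) * sqrt 2 + (sqrt 5 - sqrt 2) * real k
      = 2 * sqrt 5 + (real n - 3) * sqrt 2 + (sqrt 5 - sqrt 2) * (real k - 2)" for k
    by (simp add: algebra_simps)
  have gap: "0 < sqrt 5 - sqrt (2::real)"
    by simp
  {
    assume n3: "3 \<le> n"
    have leaves: "2 \<le> card (leaves T)"
      and path: "card (leaves T) = 2 \<longleftrightarrow> T \<cong>\<^sub>g path_graph n"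
      using tree_graph_card_leaves[OF T] tree_graph_iso_path_iff[OF T n] n n3 by simp_all
    have bound: "2 * sqrt 5 + (real n - 3) * sqrt 2 + (sqrt 5 - sqrt 2) * (real (card (leaves T)) - 2)
        \<le> HSO T"
      using tree_HSO_lower(1)[OF T] n3 by (simp add: n lower_eq)
    have "0 \<le> (sqrt 5 - sqrt 2) * (real (card (leaves T)) - 2)"
      using gap leaves by (intro mult_nonneg_nonneg) auto
    then show "2 * sqrt 5 + (real n - 3) * sqrt 2 \<le> HSO T"
      using bound by linarith
    show "2 * sqrt 5 + (real n - 3) * sqrt 2 = HSO T \<longleftrightarrow> T \<cong>\<^sub>g path_graph n"
    proof
      assume "2 * sqrt 5 + (real n - 3) * sqrt 2 = HSO T"
      then have "(sqrt 5 - sqrt 2) * (real (card (leaves T)) - 2) \<le> 0"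
        using bound by linarith
      then have "card (leaves T) = 2"
        using gap leaves by (simp add: mult_le_0_iff)
      then show "T \<cong>\<^sub>g path_graph n"
        using path by simp
    next
      assume "T \<cong>\<^sub>g path_graph n"
      then show "2 * sqrt 5 + (real n - 3) * sqrt 2 = HSO T"
        using tree_HSO_lower(2)[OF T] tree_graph_iso_path_iff[OF T n] path n3
        by (simp add: n lower_eq)
    qed
  }
  have n1: "1 \<le> n"
    using tree_graph_card_pos[OF T] n by simp
  have radicand: "(real n)\<^sup>2 - 2 * real n + 2 = 1 + (real (n - 1))\<^sup>2"
    using n1 by (simp add: of_nat_diff power2_eq_square algebra_simps)
  have deg_le: "degree T v \<le> n - 1" if "v \<in> pverts T" for v
    using degree_le[OF that] n by simp
  show "HSO T \<le> (real n - 1) * sqrt ((real n)\<^sup>2 - 2 * real n + 2)"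
    unfolding radicand using tree_HSO_le_max_degree[OF T deg_le] n by simp
  show "HSO T = (real n - 1) * sqrt ((real n)\<^sup>2 - 2 * real n + 2) \<longleftrightarrow> T \<cong>\<^sub>g star_graph n"
    unfolding radicand tree_graph_iso_star_iff[OF T n]
  proof
    assume eq: "HSO T = (real n - 1) * sqrt (1 + (real (n - 1))\<^sup>2)"
    show "\<exists>c\<in>pverts T. degree T c = n - 1"
    proof (rule ccontr)
      assume "\<not> ?thesis"
      then have less: "degree T v < n - 1" if "v \<in> pverts T" for v
        using deg_le that le_neq_implies_less by blast
      obtain v where "v \<in> pverts T"
        using tree_graph_exists_leaf[OF T] .
      then have n2: "2 \<le> n"
        using less by fastforce
      \<comment> \<open>The estimate by the largest degree now improves strictly.\<close>
      have "degree T v \<le> n - 2" if "v \<in> pverts T" for v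
        using less[OF that] by simp
      then have "HSO T \<le> (real n - 1) * sqrt (1 + (real (n - 2))\<^sup>2)"
        using tree_HSO_le_max_degree[OF T] n by simp
      also have "\<dots> < (real n - 1) * sqrt (1 + (real (n - 1))\<^sup>2)"
        using n2 by (intro mult_strict_left_mono) (auto intro!: power_strict_mono)
      finally show False
        using eq by simp
    qed
  next
    assume "\<exists>c\<in>pverts T. degree T c = n - 1"
    then show "HSO T = (real n - 1) * sqrt (1 + (real (n - 1))\<^sup>2)"
      using tree_HSO_full_degree[OF T] n by auto
  qed
qed

end
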